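(* There is a function $f\in\mathcal{HK}$ such that $P[f]$ is not the difference of two positive harmonic functions on $D$.
   Context: $D$ is the open unit disc in $\mathbb{R}^2$. $\mathcal{HK}$ is the set of $2\pi$-periodic functions $f:\mathbb{R}\to\mathbb{R}$ that are Henstock--Kurzweil integrable over a period, equivalently with finite Alexiewicz norm $\|f\|:=\sup_I|\int_I f|$, the supremum being over intervals $I\subset\mathbb{R}$ of length at most $2\pi$. The Poisson kernel is $\Phi_r(\theta)=\frac{1-r^2}{2\pi(1-2r\cos\theta+r^2)}$ and the Poisson integral of $f$ is $P[f](re^{i\theta})=\int_{-\pi}^{\pi}f(\phi)\Phi_r(\phi-\theta)\,d\phi$ (a Henstock--Kurzweil integral), $re^{i\theta}\in D$. *)

theory Defs
  imports "HOL-Analysis.Analysis"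
begin

definition HK :: "(real \<Rightarrow> real) set" where
  "HK = {f. (\<forall>x. f (x + 2 * pi) = f x) \<and> f integrable_on {-pi..pi}}"

definition poisson_kernel :: "real \<Rightarrow> real \<Rightarrow> real" where
  "poisson_kernel r \<theta> = (1 - r\<^sup>2) / (2 * pi * (1 - 2 * r * cos \<theta> + r\<^sup>2))"

text \<open>The plane is identified with the type of complex numbers. The choice of the argument
  (in particular at the origin) is immaterial: see \<open>poisson_integral_polar\<close> below.\<close>

definition poisson_integral :: "(real \<Rightarrow> real) \<Rightarrow> complex \<Rightarrow> real" where
  "poisson_integral f z =
     integral {-pi..pi} (\<lambda>\<phi>. f \<phi> * poisson_kernel (cmod z) (\<phi> - Arg z))"

lemma poisson_integral_polar:
  assumes "0 \<le> r"
  shows "poisson_integral f (of_real r * cis \<theta>) =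
           integral {-pi..pi} (\<lambda>\<phi>. f \<phi> * poisson_kernel r (\<phi> - \<theta>))"
proof (cases "r = 0")
  case True
  then show ?thesis by (simp add: poisson_integral_def poisson_kernel_def)
next
  case False
  with assms have r: "r > 0" by simp
  let ?z = "of_real r * cis \<theta>"
  have nz: "cmod ?z = r" using r by (simp add: norm_mult)
  have "cis (Arg ?z) = sgn ?z" using r by (intro cis_Arg) simp
  also have "\<dots> = cis \<theta>" using r nz by (simp add: sgn_eq del: norm_mult)
  finally have "cis (Arg ?z) = cis \<theta>" .
  then have "cos (Arg ?z) = cos \<theta>" "sin (Arg ?z) = sin \<theta>"
    by (simp_all add: complex_eq_iff)
  then have "cos (\<phi> - Arg ?z) = cos (\<phi> - \<theta>)" for \<phi>
    by (simp add: cos_diff)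
  then have "poisson_kernel r (\<phi> - Arg ?z) = poisson_kernel r (\<phi> - \<theta>)" for \<phi>
    by (simp add: poisson_kernel_def)
  with nz show ?thesis by (simp add: poisson_integral_def)
qed

definition partial_deriv :: "'a::euclidean_space \<Rightarrow> ('a \<Rightarrow> real) \<Rightarrow> 'a \<Rightarrow> real" where
  "partial_deriv b u z = frechet_derivative u (at z) b"

definition C1_on :: "('a::euclidean_space \<Rightarrow> real) \<Rightarrow> 'a set \<Rightarrow> bool" where
  "C1_on u S \<longleftrightarrow> u differentiable_on S \<and> (\<forall>b\<in>Basis. continuous_on S (partial_deriv b u))"

definition C2_on :: "('a::euclidean_space \<Rightarrow> real) \<Rightarrow> 'a set \<Rightarrow> bool" where
  "C2_on u S \<longleftrightarrow> C1_on u S \<and> (\<forall>b\<in>Basis. C1_on (partial_deriv b u) S)"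

definition laplacian :: "('a::euclidean_space \<Rightarrow> real) \<Rightarrow> 'a \<Rightarrow> real" where
  "laplacian u z = (\<Sum>b\<in>Basis. partial_deriv b (partial_deriv b u) z)"

definition harmonic_on :: "('a::euclidean_space \<Rightarrow> real) \<Rightarrow> 'a set \<Rightarrow> bool" where
  "harmonic_on u S \<longleftrightarrow> open S \<and> C2_on u S \<and> (\<forall>z\<in>S. laplacian u z = 0)"

abbreviation unit_disc :: "complex set" where
  "unit_disc \<equiv> ball 0 1"

end

(* If P[f] = u - v with u, v positive harmonic, then by the mean value property the integral of
   |P[f]| over every circle of radius r < 1 is at most 2 pi (u 0 + v 0). Integration by parts makes
   P[f] on such a circle the angular derivative of P[F], where F is a continuous primitive of f,
   and P[F] tends to F as r tends to 1; hence F has bounded variation. But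
   F x = sin x * sin (1 / sin x) has unbounded variation, while its derivative is
   Henstock-Kurzweil integrable. *)
theory Submission
  imports Defs
begin

section \<open>Derivatives along rays and circles\<close>

text \<open>By real linearity the Frechet derivative is determined by its values at 1 and
  \<open>\<i>\<close>. This gradient form is what the chain rule needs along rays and along
  circles.\<close>

lemma has_derivative_partial_deriv:
  fixes u :: "complex \<Rightarrow> real"
  assumes "u differentiable (at z)"
  shows "(u has_derivative (\<lambda>h. Re h * partial_deriv 1 u z + Im h * partial_deriv \<i> u z)) (at z)"
proof -
  let ?L = "frechet_derivative u (at z)"
  have L: "(u has_derivative ?L) (at z)"
    using assms by (simp add: frechet_derivative_works)
  then have lin: "linear ?L" by (rule has_derivative_linear)
  have "?L h = Re h * partial_deriv 1 u z + Im h * partial_deriv \<i> u z" for h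
  proof -
    have "h = Re h *\<^sub>R 1 + Im h *\<^sub>R \<i>" by (simp add: complex_eq_iff)
    then have "?L h = ?L (Re h *\<^sub>R 1 + Im h *\<^sub>R \<i>)" by simp
    then show ?thesis
      by (simp only: linear_add[OF lin] linear_scale[OF lin] partial_deriv_def real_scaleR_def)
  qed
  then have "?L = (\<lambda>h. Re h * partial_deriv 1 u z + Im h * partial_deriv \<i> u z)" by blast
  with L show ?thesis by simp
qed

lemma radial_derivative:
  fixes u :: "complex \<Rightarrow> real"
  assumes "u differentiable (at (of_real r * cis \<theta>))"
  shows "((\<lambda>r. u (of_real r * cis \<theta>)) has_real_derivative
           cos \<theta> * partial_deriv 1 u (of_real r * cis \<theta>) + sin \<theta> * partial_deriv \<i> u (of_real r * cis \<theta>)) (at r)"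
proof -
  have "((\<lambda>r. of_real r * cis \<theta>) has_derivative (\<lambda>h. of_real h * cis \<theta>)) (at r)"
    by (auto intro!: derivative_eq_intros)
  from has_derivative_compose[OF this has_derivative_partial_deriv[OF assms]]
  show ?thesis
    unfolding has_field_derivative_def by (rule has_derivative_eq_rhs) (auto simp: algebra_simps)
qed

lemma angular_derivative:
  fixes u :: "complex \<Rightarrow> real"
  assumes "u differentiable (at (of_real r * cis \<theta>))"
  shows "((\<lambda>\<theta>. u (of_real r * cis \<theta>)) has_real_derivative
           r * (cos \<theta> * partial_deriv \<i> u (of_real r * cis \<theta>) - sin \<theta> * partial_deriv 1 u (of_real r * cis \<theta>))) (at \<theta>)"
proof -
  have eq: "of_real r * cis t = of_real (r * cos t) + \<i> * of_real (r * sin t)" for t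
    by (simp add: complex_eq_iff)
  have "((\<lambda>\<theta>. of_real r * cis \<theta>) has_derivative (\<lambda>h. of_real h * (of_real r * (\<i> * cis \<theta>)))) (at \<theta>)"
    unfolding eq
    by (rule derivative_eq_intros refl | simp)+
       (auto simp: fun_eq_iff complex_eq_iff algebra_simps)
  from has_derivative_compose[OF this has_derivative_partial_deriv[OF assms]]
  show ?thesis
    unfolding has_field_derivative_def by (rule has_derivative_eq_rhs) (auto simp: algebra_simps)
qed

section \<open>The mean value property\<close>

text \<open>In polar coordinates the Laplace equation reads \<open>(s u_s)_s = - u_tt / s\<close>,
  with \<open>t\<close> the angle. Integrated over a full circle the right side vanishes by
  periodicity, so the integral of \<open>s u_s\<close> is constant in \<open>s\<close>. It is 0 at
  \<open>s = 0\<close>, hence the circle integral of \<open>u\<close> has derivative 0 for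
  \<open>s > 0\<close> and keeps its value at the centre.\<close>

lemma harmonic_circle_integral:
  fixes u :: "complex \<Rightarrow> real"
  assumes harm: "harmonic_on u (ball 0 R)" and "0 \<le> r" "r < R"
  shows "((\<lambda>\<theta>. u (of_real r * cis \<theta>)) has_integral 2 * pi * u 0) {-pi..pi}"
proof -
  define B where "B = ball (0::complex) R"
  define U where "U = {-R<..<R}"
  define p where "p = partial_deriv 1 u"
  define q where "q = partial_deriv \<i> u"
  have "open B" by (simp add: B_def)
  have C1u: "C1_on u B" and C1p: "C1_on p B" and C1q: "C1_on q B"
    and lap: "\<And>z. z \<in> B \<Longrightarrow> partial_deriv 1 p z + partial_deriv \<i> q z = 0"
    using harm by (auto simp: harmonic_on_def C2_on_def B_def p_def q_def laplacian_def Basis_complex_def)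
  have diff: "w differentiable (at z)" "continuous_on B w"
    "continuous_on B (partial_deriv 1 w)" "continuous_on B (partial_deriv \<i> w)"
    if "C1_on w B" "z \<in> B" for w z
    using that \<open>open B\<close>
    by (auto simp: C1_on_def Basis_complex_def differentiable_on_eq_differentiable_at
          differentiable_imp_continuous_on)
  have inB: "of_real s * cis \<theta> \<in> B" if "s \<in> U" for s \<theta>
    using that by (auto simp: B_def U_def norm_mult)
  have cont2: "continuous_on (U \<times> {-pi..pi}) (\<lambda>x. w (of_real (fst x) * cis (snd x)))"
    if "continuous_on B w" for w :: "complex \<Rightarrow> real"
    by (rule continuous_on_compose2[OF that]) (auto intro!: continuous_intros inB)
  have cont1: "continuous_on {-pi..pi} (\<lambda>\<theta>. w (of_real s * cis \<theta>))"
    if "continuous_on B w" "s \<in> U" for w :: "complex \<Rightarrow> real" and s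
    by (rule continuous_on_compose2[OF that(1)]) (use that(2) in \<open>auto intro!: continuous_intros inB\<close>)
  have B0: "0 \<in> B" "0 \<in> U" "r \<in> U" using assms by (auto simp: B_def U_def)
  note c = diff(2)[OF C1u B0(1)] diff(2)[OF C1p B0(1)] diff(2)[OF C1q B0(1)]
    diff(3,4)[OF C1p B0(1)] diff(3,4)[OF C1q B0(1)]
  \<comment> \<open>With subscripts for polar derivatives: \<open>d s\<close> is \<open>u_s\<close>,
    \<open>h s\<close> is the circle integral of \<open>s u_s\<close>, and \<open>e s\<close> is the
    radial derivative of \<open>s u_s\<close>.\<close>
  define m where "m = (\<lambda>s. integral {-pi..pi} (\<lambda>\<theta>. u (of_real s * cis \<theta>)))"
  define d where "d = (\<lambda>s \<theta>. cos \<theta> * p (of_real s * cis \<theta>) + sin \<theta> * q (of_real s * cis \<theta>))"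
  define h where "h = (\<lambda>s. integral {-pi..pi} (\<lambda>\<theta>. s * d s \<theta>))"
  define e where "e = (\<lambda>s \<theta>. d s \<theta> + s * (cos \<theta> * (cos \<theta> * partial_deriv 1 p (of_real s * cis \<theta>)
      + sin \<theta> * partial_deriv \<i> p (of_real s * cis \<theta>)) + sin \<theta> * (cos \<theta> * partial_deriv 1 q (of_real s * cis \<theta>)
      + sin \<theta> * partial_deriv \<i> q (of_real s * cis \<theta>))))"
  have open_U: "open U" and conv_U: "convex U" by (auto simp: U_def)
  have dm: "(m has_real_derivative integral {-pi..pi} (d s)) (at s)" if s: "s \<in> U" for s
  proof -
    have "((\<lambda>x. integral (cbox (-pi) pi) (\<lambda>\<theta>. u (of_real x * cis \<theta>))) has_real_derivative
        integral (cbox (-pi) pi) (d s)) (at s within U)"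
      using s conv_U
    proof (intro leibniz_rule_field_derivative)
      show "((\<lambda>x. u (of_real x * cis t)) has_real_derivative d x t) (at x within U)" if "x \<in> U" for x t
        unfolding d_def p_def q_def
        by (rule has_field_derivative_at_within, rule radial_derivative, rule diff(1)[OF C1u inB[OF that]])
      show "(\<lambda>\<theta>. u (of_real x * cis \<theta>)) integrable_on cbox (-pi) pi" if "x \<in> U" for x
        unfolding box_real by (rule integrable_continuous_real, rule cont1) (use c that in auto)
      show "continuous_on (U \<times> cbox (-pi) pi) (\<lambda>(x, t). d x t)"
        unfolding d_def case_prod_unfold box_real
        by (intro continuous_intros cont2 c)
    qed
    then show ?thesis using s open_U by (simp add: m_def at_within_open[of s U])
  qed
  have dh: "(h has_real_derivative integral {-pi..pi} (e s)) (at s)" if s: "s \<in> U" for s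
  proof -
    have "((\<lambda>x. integral (cbox (-pi) pi) (\<lambda>\<theta>. x * d x \<theta>)) has_real_derivative
        integral (cbox (-pi) pi) (e s)) (at s within U)"
      using s conv_U
    proof (intro leibniz_rule_field_derivative)
      show "((\<lambda>x. x * d x t) has_real_derivative e x t) (at x within U)" if "x \<in> U" for x t
      proof (rule has_field_derivative_at_within)
        show "((\<lambda>x. x * d x t) has_real_derivative e x t) (at x)"
          unfolding e_def d_def
          by (rule derivative_eq_intros radial_derivative diff(1)[OF C1p inB[OF that]]
              diff(1)[OF C1q inB[OF that]] refl)+ (simp add: algebra_simps)
      qed
      show "(\<lambda>\<theta>. x * d x \<theta>) integrable_on cbox (-pi) pi" if "x \<in> U" for x
        unfolding box_real d_def
        by (rule integrable_continuous_real, intro continuous_intros cont1 c that)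
      show "continuous_on (U \<times> cbox (-pi) pi) (\<lambda>(x, t). e x t)"
        unfolding e_def d_def case_prod_unfold box_real
        by (intro continuous_intros cont2 c)
    qed
    then show ?thesis using s open_U by (simp add: h_def at_within_open[of s U])
  qed
  (* harmonicity turns e s into the derivative of a periodic function, see g below *)
  have e0: "integral {-pi..pi} (e s) = 0" if s: "s \<in> U" for s
  proof -
    \<comment> \<open>This is \<open>- u_t / s\<close> with the division carried out, so that
      \<open>s = 0\<close> is covered as well.\<close>
    define g where "g = (\<lambda>\<theta>. sin \<theta> * p (of_real s * cis \<theta>) - cos \<theta> * q (of_real s * cis \<theta>))"
    have "(g has_real_derivative e s \<theta>) (at \<theta>)" for \<theta>
    proof -
      \<comment> \<open>In \<open>e s\<close> and in the derivative of \<open>g\<close> the mixed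
        second derivatives enter alike; the pure ones agree after this substitution, by
        \<open>cos\<^sup>2 + sin\<^sup>2 = 1\<close> being left out of account on neither side:
        \<open>p_1\<close> is traded for \<open>- q_\<i>\<close> in both.\<close>
      have L: "partial_deriv 1 p (of_real s * cis \<theta>) = - partial_deriv \<i> q (of_real s * cis \<theta>)"
        using lap[OF inB[OF s]] by (simp add: add_eq_0_iff2)
      show ?thesis
        unfolding g_def
        by (rule derivative_eq_intros angular_derivative diff(1)[OF C1p inB[OF s]]
              diff(1)[OF C1q inB[OF s]] refl)+ (simp only: e_def d_def L, simp add: algebra_simps)
    qed
    then have "(e s has_integral g pi - g (-pi)) {-pi..pi}"
      by (intro fundamental_theorem_of_calculus)
         (auto simp: has_real_derivative_iff_has_vector_derivative[symmetric]
           intro: has_field_derivative_at_within)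
    moreover have "g (-pi) = g pi"
    proof -
      have "cis (- pi) = cis pi" by (simp add: complex_eq_iff)
      then show ?thesis unfolding g_def by (simp only:) simp
    qed
    ultimately show ?thesis by (intro integral_unique) simp
  qed
  have "m r = m 0"
  proof (cases "r = 0")
    case False
    then have "0 < r" using assms by simp
    have sub: "s \<in> U" if "0 \<le> s" "s \<le> r" for s using that assms by (auto simp: U_def)
    \<comment> \<open>The factor \<open>s\<close> in \<open>h\<close> makes \<open>h 0 = 0\<close>;
      for \<open>s > 0\<close> it can afterwards be cancelled, which leaves the derivative of
      \<open>m\<close> equal to 0.\<close>
    have h0: "h s = 0" if "0 < s" "s \<le> r" for s
    proof -
      have "h s = h 0"
      proof (rule DERIV_isconst_end[OF \<open>0 < s\<close>])
        show "continuous_on {0..s} h"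
          by (intro continuous_at_imp_continuous_on ballI DERIV_isCont[OF dh]) (use that in \<open>auto intro: sub\<close>)
        fix x assume "0 < x" "x < s"
        then have "x \<in> U" using that by (intro sub) auto
        then show "(h has_real_derivative 0) (at x)" using dh[of x] e0[of x] by simp
      qed
      then show ?thesis by (simp add: h_def)
    qed
    show ?thesis
    proof (rule DERIV_isconst_end[OF \<open>0 < r\<close>])
      show "continuous_on {0..r} m"
        by (intro continuous_at_imp_continuous_on ballI DERIV_isCont[OF dm]) (auto intro: sub)
      fix s assume "0 < s" "s < r"
      moreover from this have "integral {-pi..pi} (d s) = 0"
        using h0[of s] by (simp add: h_def)
      ultimately show "(m has_real_derivative 0) (at s)"
        using dm[of s] sub[of s] by simp
    qed
  qed simp
  then have "m r = 2 * pi * u 0" by (simp add: m_def)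
  moreover have "(\<lambda>\<theta>. u (of_real r * cis \<theta>)) integrable_on {-pi..pi}"
    by (rule integrable_continuous_real, rule cont1[OF c(1)]) (rule B0)
  ultimately show ?thesis by (simp add: m_def has_integral_iff)
qed

section \<open>The Poisson kernel: sign, angular derivative and total mass\<close>

lemma poisson_denominator_pos:
  fixes r t :: real
  assumes "0 \<le> r" "r < 1"
  shows "1 - 2 * r * cos t + r\<^sup>2 > 0"
proof -
  have "0 < (1 - r)\<^sup>2" using assms by simp
  also have "\<dots> \<le> (1 - r)\<^sup>2 + 2 * r * (1 - cos t)" using assms by simp
  also have "\<dots> = 1 - 2 * r * cos t + r\<^sup>2" by (simp add: algebra_simps power2_eq_square)
  finally show ?thesis .
qed

lemma poisson_kernel_nonneg: "0 \<le> r \<Longrightarrow> r < 1 \<Longrightarrow> 0 \<le> poisson_kernel r t"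
  using poisson_denominator_pos[of r t]
  by (auto simp: poisson_kernel_def power_le_one intro!: divide_nonneg_nonneg)

definition poisson_kernel_deriv :: "real \<Rightarrow> real \<Rightarrow> real" where
  "poisson_kernel_deriv r t = - ((1 - r\<^sup>2) * (2 * r * sin t)) / (2 * pi * (1 - 2 * r * cos t + r\<^sup>2)\<^sup>2)"

lemma poisson_kernel_has_derivative:
  assumes "0 \<le> r" "r < 1"
  shows "(poisson_kernel r has_real_derivative poisson_kernel_deriv r t) (at t)"
proof -
  define D where "D = 1 - 2 * r * cos t + r\<^sup>2"
  have D: "D > 0" unfolding D_def by (rule poisson_denominator_pos[OF assms])
  have "((\<lambda>t. 2 * pi * (1 - 2 * r * cos t + r\<^sup>2)) has_real_derivative 2 * pi * (2 * r * sin t)) (at t)"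
    by (auto intro!: derivative_eq_intros)
  from DERIV_divide[OF DERIV_const[of "1 - r\<^sup>2"] this]
  have "(poisson_kernel r has_real_derivative
      (0 * (2 * pi * D) - (1 - r\<^sup>2) * (2 * pi * (2 * r * sin t))) / ((2 * pi * D) * (2 * pi * D))) (at t)"
    using D unfolding poisson_kernel_def[abs_def] D_def by simp
  moreover have "(0 * (2 * pi * D) - (1 - r\<^sup>2) * (2 * pi * (2 * r * sin t))) / ((2 * pi * D) * (2 * pi * D))
      = poisson_kernel_deriv r t"
    unfolding poisson_kernel_deriv_def D_def[symmetric]
    using D by (simp add: divide_simps power2_eq_square)
  ultimately show ?thesis by simp
qed

lemma continuous_on_poisson_kernel [continuous_intros]:
  fixes g :: "'a::t2_space \<Rightarrow> real"
  assumes "0 \<le> r" "r < 1" "continuous_on A g"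
  shows "continuous_on A (\<lambda>x. poisson_kernel r (g x))"
proof -
  have "2 * pi * (1 - 2 * r * cos t + r\<^sup>2) \<noteq> 0" for t
    using poisson_denominator_pos[OF assms(1,2), of t] by (intro no_zero_divisors) simp_all
  then show ?thesis
    unfolding poisson_kernel_def by (intro continuous_intros assms(3) ballI)
qed

lemma continuous_on_poisson_kernel_deriv [continuous_intros]:
  fixes g :: "'a::t2_space \<Rightarrow> real"
  assumes "0 \<le> r" "r < 1" "continuous_on A g"
  shows "continuous_on A (\<lambda>x. poisson_kernel_deriv r (g x))"
proof -
  have "2 * pi * (1 - 2 * r * cos t + r\<^sup>2)\<^sup>2 \<noteq> 0" for t
    using poisson_denominator_pos[OF assms(1,2), of t] by (intro no_zero_divisors power_not_zero) simp_all
  then show ?thesis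
    unfolding poisson_kernel_deriv_def by (intro continuous_intros assms(3) ballI)
qed

(* up to the factor 1 / (2 * pi) the antiderivative is the sum of the series obtained by integrating
   1 + 2 * (\<Sum>n\<ge>1. r^n * cos (n t)) term by term *)
lemma poisson_kernel_has_integral_1:
  assumes "0 \<le> r" "r < 1"
  shows "((\<lambda>\<phi>. poisson_kernel r (\<phi> - \<theta>)) has_integral 1) {-pi..pi}"
proof -
  define A where "A = (\<lambda>t. (t + 2 * arctan (r * sin t / (1 - r * cos t))) / (2 * pi))"
  have A: "(A has_real_derivative poisson_kernel r t) (at t)" for t
  proof -
    let ?D = "1 - 2 * r * cos t + r\<^sup>2"
    \<comment> \<open>The argument of \<open>arctan\<close> has no pole, so \<open>A\<close> is
      differentiable on the whole line and no branch has to be chosen.\<close>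
    have "r * cos t \<le> r * 1" using assms by (intro mult_left_mono) auto
    then have nz: "1 - r * cos t \<noteq> 0" using assms by linarith
    have D: "?D \<noteq> 0" using poisson_denominator_pos[OF assms, of t] by simp
    have sq: "(1 - r * cos t)\<^sup>2 + (r * sin t)\<^sup>2 = ?D"
      using sin_cos_squared_add[of t] by algebra
    have *: "1 + (r * sin t / (1 - r * cos t))\<^sup>2 = ?D / (1 - r * cos t)\<^sup>2"
      using nz sq by (simp add: field_simps)
    have "((\<lambda>t. r * sin t / (1 - r * cos t)) has_real_derivative
        (r * cos t - r\<^sup>2) / (1 - r * cos t)\<^sup>2) (at t)"
    proof -
      have "((\<lambda>t. r * sin t) has_real_derivative r * cos t) (at t)"
        "((\<lambda>t. 1 - r * cos t) has_real_derivative r * sin t) (at t)"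
        by (auto intro!: derivative_eq_intros)
      from DERIV_divide[OF this nz] show ?thesis
      proof (rule DERIV_cong)
        have "r * cos t * (1 - r * cos t) - r * sin t * (r * sin t) = r * cos t - r\<^sup>2"
          using sin_cos_squared_add[of t] by algebra
        then show "(r * cos t * (1 - r * cos t) - r * sin t * (r * sin t)) / ((1 - r * cos t) * (1 - r * cos t)) =
            (r * cos t - r\<^sup>2) / (1 - r * cos t)\<^sup>2"
          by (simp add: power2_eq_square)
      qed
    qed
    from DERIV_chain2[OF DERIV_arctan this]
    have "((\<lambda>t. arctan (r * sin t / (1 - r * cos t))) has_real_derivative (r * cos t - r\<^sup>2) / ?D) (at t)"
      by (rule DERIV_cong) (use nz in \<open>simp add: *\<close>)
    then have "(A has_real_derivative (1 + 2 * ((r * cos t - r\<^sup>2) / ?D)) / (2 * pi)) (at t)"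
      unfolding A_def by (intro DERIV_cdivide DERIV_add DERIV_ident DERIV_cmult)
    moreover have "(1 + 2 * ((r * cos t - r\<^sup>2) / ?D)) / (2 * pi) = poisson_kernel r t"
      unfolding poisson_kernel_def using D by (simp add: field_simps)
    ultimately show ?thesis by simp
  qed
  have "((\<lambda>\<phi>. A (\<phi> - \<theta>)) has_real_derivative poisson_kernel r (\<phi> - \<theta>)) (at \<phi>)" for \<phi>
    by (rule DERIV_chain2[where f = A and g = "\<lambda>x. x - \<theta>" and Db = 1, OF A, THEN DERIV_cong])
       (auto intro!: derivative_eq_intros)
  then have "((\<lambda>\<phi>. poisson_kernel r (\<phi> - \<theta>)) has_integral A (pi - \<theta>) - A (- pi - \<theta>)) {-pi..pi}"
    by (intro fundamental_theorem_of_calculus)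
       (auto simp: has_real_derivative_iff_has_vector_derivative[symmetric]
         intro: has_field_derivative_at_within)
  \<comment> \<open>Over one period the \<open>arctan\<close> term returns to its value, and only
    \<open>t / (2 * pi)\<close> contributes.\<close>
  moreover have "A (t - 2 * pi) = A t - 1" for t
    by (simp add: A_def sin_diff cos_diff diff_divide_distrib add_divide_distrib)
  from this[of "pi - \<theta>"] have "A (pi - \<theta>) - A (- pi - \<theta>) = 1"
    by simp
  ultimately show ?thesis by simp
qed

section \<open>Convergence to continuous boundary values\<close>

text \<open>Since the kernel has mass 1, the error is the integral of
  \<open>F \<phi> - F \<theta>\<close> against it. This difference is at most a small constant plus
  a multiple of \<open>1 - cos (\<phi> - \<theta>)\<close>, and that weight times the kernel is
  bounded, uniformly in the angle, by a quantity tending to 0 with \<open>1 - r\<close>.\<close>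

lemma poisson_integral_tendsto:
  fixes F :: "real \<Rightarrow> real"
  assumes cont: "continuous_on {-pi..pi} F" and \<theta>: "-pi < \<theta>" "\<theta> < pi"
  shows "((\<lambda>r. integral {-pi..pi} (\<lambda>\<phi>. F \<phi> * poisson_kernel r (\<phi> - \<theta>))) \<longlongrightarrow> F \<theta>) (at_left 1)"
proof (rule tendstoI)
  fix e :: real assume "e > 0"
  define G where "G = (\<lambda>r. integral {-pi..pi} (\<lambda>\<phi>. F \<phi> * poisson_kernel r (\<phi> - \<theta>)))"
  define \<epsilon> where "\<epsilon> = e / 2"
  have "\<epsilon> > 0" using \<open>e > 0\<close> by (simp add: \<epsilon>_def)
  obtain K where K: "\<And>\<phi>. \<phi> \<in> {-pi..pi} \<Longrightarrow> \<bar>F \<phi>\<bar> \<le> K"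
  proof -
    have "bounded (F ` {-pi..pi})"
      by (intro compact_imp_bounded compact_continuous_image cont) auto
    then show ?thesis using that by (metis bounded_iff imageI real_norm_def)
  qed
  then have "K \<ge> 0" using \<theta> by (intro order_trans[OF abs_ge_zero K[of \<theta>]]) auto
  obtain \<delta>0 where \<delta>0: "\<delta>0 > 0" "\<And>\<phi>. \<phi> \<in> {-pi..pi} \<Longrightarrow> \<bar>\<phi> - \<theta>\<bar> < \<delta>0 \<Longrightarrow> \<bar>F \<phi> - F \<theta>\<bar> < \<epsilon>"
  proof -
    have "\<theta> \<in> {-pi..pi}" using \<theta> by simp
    with cont \<open>\<epsilon> > 0\<close> have "\<exists>d>0. \<forall>x\<in>{-pi..pi}. dist x \<theta> < d \<longrightarrow> dist (F x) (F \<theta>) < \<epsilon>"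
      unfolding continuous_on_iff by blast
    then show ?thesis using that by (auto simp: dist_real_def)
  qed
  \<comment> \<open>The bounds \<open>pi - \<theta>\<close> and \<open>pi + \<theta>\<close> serve
    \<open>far\<close>: when \<open>\<bar>\<phi> - \<theta>\<bar>\<close> exceeds \<open>pi\<close>,
    the distance the other way round the circle is still at least \<open>\<delta>\<close>.\<close>
  define \<delta> where "\<delta> = min \<delta>0 (min (pi - \<theta>) (pi + \<theta>))"
  have \<delta>: "0 < \<delta>" "\<delta> \<le> pi" "\<delta> \<le> \<delta>0" "\<delta> \<le> pi - \<theta>" "\<delta> \<le> pi + \<theta>"
    using \<delta>0 \<theta> by (auto simp: \<delta>_def min_def)
  have cosd: "cos \<delta> < 1" using cos_monotone_0_pi[of 0 \<delta>] \<delta> by simp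
  have far: "cos (\<phi> - \<theta>) \<le> cos \<delta>" if "\<phi> \<in> {-pi..pi}" "\<delta> \<le> \<bar>\<phi> - \<theta>\<bar>" for \<phi>
  proof (cases "\<bar>\<phi> - \<theta>\<bar> \<le> pi")
    case True
    then have "cos \<bar>\<phi> - \<theta>\<bar> \<le> cos \<delta>" using that \<delta> by (intro cos_monotone_0_pi_le) auto
    then show ?thesis by simp
  next
    case False
    then have "cos (2 * pi - \<bar>\<phi> - \<theta>\<bar>) \<le> cos \<delta>"
      using that \<delta> \<theta> by (intro cos_monotone_0_pi_le) auto
    moreover have "cos (2 * pi - \<bar>\<phi> - \<theta>\<bar>) = cos \<bar>\<phi> - \<theta>\<bar>"
      by (rule cos_2pi_minus)
    ultimately show ?thesis by simp
  qed
  \<comment> \<open>Chosen so that \<open>C * (1 - cos \<delta>) = 2 * K\<close>, which dominates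
    any difference of two values of \<open>F\<close>.\<close>
  define C where "C = 2 * K / (1 - cos \<delta>)"
  have "C \<ge> 0" using cosd \<open>K \<ge> 0\<close> by (simp add: C_def)
  (* the factor 1 - cos (\<phi> - \<theta>) cancels the peak of the kernel *)
  have near: "\<bar>F \<phi> - F \<theta>\<bar> \<le> \<epsilon> + C * (1 - cos (\<phi> - \<theta>))" if "\<phi> \<in> {-pi..pi}" for \<phi>
  proof (cases "\<bar>\<phi> - \<theta>\<bar> < \<delta>")
    case True
    then have "\<bar>F \<phi> - F \<theta>\<bar> < \<epsilon>" using \<delta>0(2)[OF that] \<delta> by simp
    moreover have "0 \<le> C * (1 - cos (\<phi> - \<theta>))" using \<open>C \<ge> 0\<close> by simp
    ultimately show ?thesis by simp
  next
    case False
    then have "C * (1 - cos \<delta>) \<le> C * (1 - cos (\<phi> - \<theta>))"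
      using far[OF that] \<open>C \<ge> 0\<close> by (intro mult_left_mono) auto
    moreover have "C * (1 - cos \<delta>) = 2 * K" using cosd by (simp add: C_def)
    moreover have "\<bar>F \<phi> - F \<theta>\<bar> \<le> 2 * K" using K[OF that] K[of \<theta>] \<theta> by auto
    ultimately show ?thesis using \<open>\<epsilon> > 0\<close> by linarith
  qed
  have bound: "\<bar>G r - F \<theta>\<bar> \<le> \<epsilon> + C * (1 - r\<^sup>2) / (2 * r)" if r: "0 < r" "r < 1" for r
  proof -
    let ?k = "\<lambda>\<phi>. poisson_kernel r (\<phi> - \<theta>)"
    have r0: "0 \<le> r" using r by simp
    have k: "(?k has_integral 1) {-pi..pi}"
      using poisson_kernel_has_integral_1[OF r0 r(2)] .
    have "(\<lambda>\<phi>. F \<phi> * ?k \<phi>) integrable_on {-pi..pi}"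
      by (intro integrable_continuous_real continuous_intros cont r0 r)
    then have I: "((\<lambda>\<phi>. F \<phi> * ?k \<phi> - F \<theta> * ?k \<phi>) has_integral (G r - F \<theta> * 1)) {-pi..pi}"
      unfolding G_def by (intro has_integral_diff has_integral_mult_right k integrable_integral)
    \<comment> \<open>The kernel contributes \<open>\<epsilon>\<close>, having mass 1; the constant
      is divided by the length \<open>2 * pi\<close> of the interval in advance.\<close>
    have J: "((\<lambda>\<phi>. \<epsilon> * ?k \<phi> + C * (1 - r\<^sup>2) / (2 * r) * (1 / (2 * pi))) has_integral
        (\<epsilon> * 1 + (pi - (- pi)) *\<^sub>R (C * (1 - r\<^sup>2) / (2 * r) * (1 / (2 * pi))))) {-pi..pi}"
    proof (intro has_integral_add has_integral_mult_right k)
      show "((\<lambda>\<phi>. c) has_integral (pi - (- pi)) *\<^sub>R c) {-pi..pi}" for c :: real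
        using has_integral_const_real[of c "- pi" pi] by simp
    qed
    have le: "\<bar>F \<phi> * ?k \<phi> - F \<theta> * ?k \<phi>\<bar> \<le> \<epsilon> * ?k \<phi> + C * (1 - r\<^sup>2) / (2 * r) * (1 / (2 * pi))"
      if "\<phi> \<in> {-pi..pi}" for \<phi>
    proof -
      let ?D = "1 - 2 * r * cos (\<phi> - \<theta>) + r\<^sup>2"
      have D: "0 < ?D" using poisson_denominator_pos[OF r0 r(2)] .
      have k0: "0 \<le> ?k \<phi>" using poisson_kernel_nonneg[OF r0 r(2)] .
      \<comment> \<open>The two sides differ by \<open>(1 - r)\<^sup>2\<close>.\<close>
      have "2 * r * (1 - cos (\<phi> - \<theta>)) \<le> ?D"
        using zero_le_power2[of "1 - r"] by (simp add: power2_eq_square algebra_simps)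
      then have "(1 - cos (\<phi> - \<theta>)) / ?D \<le> 1 / (2 * r)"
        using D r by (simp add: field_simps)
      then have "(1 - r\<^sup>2) / (2 * pi) * ((1 - cos (\<phi> - \<theta>)) / ?D) \<le> (1 - r\<^sup>2) / (2 * pi) * (1 / (2 * r))"
        using r by (intro mult_left_mono) (auto simp: power_le_one)
      then have peak: "(1 - cos (\<phi> - \<theta>)) * ?k \<phi> \<le> (1 - r\<^sup>2) / (2 * pi) * (1 / (2 * r))"
        by (simp add: poisson_kernel_def mult.commute)
      have "\<bar>F \<phi> * ?k \<phi> - F \<theta> * ?k \<phi>\<bar> = \<bar>F \<phi> - F \<theta>\<bar> * ?k \<phi>"
        using abs_of_nonneg[OF k0] by (simp only: left_diff_distrib[symmetric] abs_mult)
      also have "\<dots> \<le> (\<epsilon> + C * (1 - cos (\<phi> - \<theta>))) * ?k \<phi>"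
        by (intro mult_right_mono near that k0)
      also have "\<dots> = \<epsilon> * ?k \<phi> + C * ((1 - cos (\<phi> - \<theta>)) * ?k \<phi>)" by (simp add: algebra_simps)
      also have "\<dots> \<le> \<epsilon> * ?k \<phi> + C * ((1 - r\<^sup>2) / (2 * pi) * (1 / (2 * r)))"
        by (intro add_left_mono mult_left_mono peak \<open>C \<ge> 0\<close>)
      finally show ?thesis by (simp add: mult_ac)
    qed
    have "norm (G r - F \<theta> * 1) \<le> \<epsilon> * 1 + (pi - (- pi)) *\<^sub>R (C * (1 - r\<^sup>2) / (2 * r) * (1 / (2 * pi)))"
      using integral_norm_bound_integral[OF has_integral_integrable[OF I] has_integral_integrable[OF J]] le
      by (simp only: integral_unique[OF I] integral_unique[OF J] real_norm_def)
    moreover have "(pi - (- pi)) *\<^sub>R (X * (1 / (2 * pi))) = X" for X :: real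
      by simp
    ultimately show ?thesis by simp
  qed
  have "((\<lambda>r::real. C * (1 - r\<^sup>2) / (2 * r)) \<longlongrightarrow> C * (1 - 1\<^sup>2) / (2 * 1)) (at_left 1)"
    by (intro tendsto_intros) auto
  then have "\<forall>\<^sub>F r in at_left 1. C * (1 - r\<^sup>2) / (2 * r) < \<epsilon>"
    using \<open>\<epsilon> > 0\<close> by (intro order_tendstoD) simp_all
  moreover have "\<forall>\<^sub>F r in at_left (1::real). r \<in> {0<..<1}"
    by (rule eventually_at_left_real) simp
  ultimately have "\<forall>\<^sub>F r in at_left 1. dist (G r) (F \<theta>) < e"
  proof eventually_elim
    case (elim r)
    then show ?case using bound[of r] by (simp add: dist_real_def \<epsilon>_def)
  qed
  then show "\<forall>\<^sub>F r in at_left 1. dist (integral {-pi..pi} (\<lambda>\<phi>. F \<phi> * poisson_kernel r (\<phi> - \<theta>))) (F \<theta>) < e"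
    by (simp only: G_def)
qed

section \<open>From Poisson integrals to the variation of a primitive\<close>

text \<open>Integration by parts moves the derivative from \<open>F\<close> to the kernel, the
  boundary terms cancelling by periodicity. As the kernel depends on
  \<open>\<phi> - \<theta>\<close>, its derivative in \<open>\<phi>\<close> is minus that in
  \<open>\<theta>\<close>, and the latter can be pulled out of the integral.\<close>

lemma poisson_integral_angular_antiderivative:
  fixes F f :: "real \<Rightarrow> real"
  assumes "finite S" and cont: "continuous_on {-pi..pi} F" and per: "F (-pi) = F pi"
    and deriv: "\<And>x. x \<in> {-pi<..<pi} - S \<Longrightarrow> (F has_real_derivative f x) (at x)"
    and r: "0 \<le> r" "r < 1"
  shows "((\<lambda>\<theta>. integral {-pi..pi} (\<lambda>\<phi>. F \<phi> * poisson_kernel r (\<phi> - \<theta>))) has_real_derivative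
           poisson_integral f (of_real r * cis \<theta>)) (at \<theta>)"
proof -
  let ?k = "poisson_kernel r" and ?k' = "poisson_kernel_deriv r"
  note k = poisson_kernel_has_derivative[OF r]
  \<comment> \<open>The product rule is integrated as a whole. Subtracting the continuous term
    \<open>F * ?k'\<close> then yields the integrability of \<open>f * ?k\<close>, so
    \<open>f\<close> itself need not be absolutely integrable.\<close>
  have "((\<lambda>\<phi>. f \<phi> * ?k (\<phi> - \<theta>) + F \<phi> * ?k' (\<phi> - \<theta>)) has_integral
      F pi * ?k (pi - \<theta>) - F (-pi) * ?k (-pi - \<theta>)) {-pi..pi}"
  proof (rule fundamental_theorem_of_calculus_interior_strong[OF \<open>finite S\<close>])
    show "continuous_on {-pi..pi} (\<lambda>\<phi>. F \<phi> * ?k (\<phi> - \<theta>))"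
      by (intro continuous_intros cont r)
    fix x assume x: "x \<in> {-pi<..<pi} - S"
    have "((\<lambda>\<phi>. ?k (\<phi> - \<theta>)) has_real_derivative ?k' (x - \<theta>)) (at x)"
      by (rule DERIV_chain2[where f = ?k and g = "\<lambda>x. x - \<theta>" and Db = 1, OF k, THEN DERIV_cong])
         (auto intro!: derivative_eq_intros)
    from DERIV_mult[OF deriv[OF x] this]
    show "((\<lambda>\<phi>. F \<phi> * ?k (\<phi> - \<theta>)) has_vector_derivative f x * ?k (x - \<theta>) + F x * ?k' (x - \<theta>)) (at x)"
      by (simp add: has_real_derivative_iff_has_vector_derivative mult.commute)
  qed simp
  moreover have "?k (pi - \<theta>) = ?k (-pi - \<theta>)"
    by (simp add: poisson_kernel_def cos_diff)
  ultimately have "((\<lambda>\<phi>. f \<phi> * ?k (\<phi> - \<theta>) + F \<phi> * ?k' (\<phi> - \<theta>)) has_integral 0) {-pi..pi}"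
    using per by simp
  moreover have "(\<lambda>\<phi>. F \<phi> * ?k' (\<phi> - \<theta>)) integrable_on {-pi..pi}"
    by (intro integrable_continuous_real continuous_intros cont r)
  ultimately have "((\<lambda>\<phi>. f \<phi> * ?k (\<phi> - \<theta>) + F \<phi> * ?k' (\<phi> - \<theta>) - F \<phi> * ?k' (\<phi> - \<theta>)) has_integral
      0 - integral {-pi..pi} (\<lambda>\<phi>. F \<phi> * ?k' (\<phi> - \<theta>))) {-pi..pi}"
    by (intro has_integral_diff integrable_integral)
  then have *: "poisson_integral f (of_real r * cis \<theta>) = integral {-pi..pi} (\<lambda>\<phi>. - (F \<phi> * ?k' (\<phi> - \<theta>)))"
    by (simp add: poisson_integral_polar[OF r(1)] integral_unique)
  have "((\<lambda>\<theta>. integral (cbox (-pi) pi) (\<lambda>\<phi>. F \<phi> * ?k (\<phi> - \<theta>))) has_real_derivative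
      integral (cbox (-pi) pi) (\<lambda>\<phi>. - (F \<phi> * ?k' (\<phi> - \<theta>)))) (at \<theta> within UNIV)"
  proof (rule leibniz_rule_field_derivative[where fx = "\<lambda>\<theta> \<phi>. - (F \<phi> * ?k' (\<phi> - \<theta>))"])
    fix x t
    have "((\<lambda>\<theta>. ?k (t - \<theta>)) has_real_derivative - ?k' (t - x)) (at x)"
      by (rule DERIV_chain2[where f = ?k and g = "\<lambda>x. t - x" and Db = "- 1", OF k, THEN DERIV_cong])
         (auto intro!: derivative_eq_intros)
    from DERIV_cmult[OF this, of "F t"]
    show "((\<lambda>x. F t * ?k (t - x)) has_real_derivative - (F t * ?k' (t - x))) (at x within UNIV)" by simp
  next
    show "(\<lambda>\<phi>. F \<phi> * ?k (\<phi> - x)) integrable_on cbox (-pi) pi" for x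
      unfolding box_real by (intro integrable_continuous_real continuous_intros cont r)
  next
    have "continuous_on (UNIV \<times> {-pi..pi}) (\<lambda>x::real \<times> real. F (snd x))"
      by (rule continuous_on_compose2[OF cont]) (auto intro!: continuous_intros)
    then show "continuous_on (UNIV \<times> cbox (-pi) pi) (\<lambda>(x, t). - (F t * ?k' (t - x)))"
      unfolding box_real case_prod_unfold by (intro continuous_intros r)
  qed auto
  then show ?thesis by (simp add: *)
qed

text \<open>For each \<open>r < 1\<close> the variation of \<open>G r\<close> is at most the circle
  integral of \<open>u + v\<close>, a bound independent of \<open>r\<close>; a sum over finitely
  many points survives the limit. Sampling along a decreasing sequence suits a function whose
  oscillations accumulate at one point.\<close>

lemma poisson_integral_difference_bounded_variation:
  fixes F f :: "real \<Rightarrow> real" and u v :: "complex \<Rightarrow> real" and a :: "nat \<Rightarrow> real"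
  assumes "finite S" and cont: "continuous_on {-pi..pi} F" and per: "F (-pi) = F pi"
    and deriv: "\<And>x. x \<in> {-pi<..<pi} - S \<Longrightarrow> (F has_real_derivative f x) (at x)"
    and harm: "harmonic_on u unit_disc" "harmonic_on v unit_disc"
    and nonneg: "\<And>z. z \<in> unit_disc \<Longrightarrow> u z \<ge> 0" "\<And>z. z \<in> unit_disc \<Longrightarrow> v z \<ge> 0"
    and eq: "\<And>z. z \<in> unit_disc \<Longrightarrow> poisson_integral f z = u z - v z"
    and a: "decseq a" "\<And>k. a k \<in> {-pi<..<pi}"
  shows "(\<Sum>k<n. \<bar>F (a k) - F (a (Suc k))\<bar>) \<le> 2 * pi * (u 0 + v 0)"
proof -
  define G where "G = (\<lambda>r \<theta>. integral {-pi..pi} (\<lambda>\<phi>. F \<phi> * poisson_kernel r (\<phi> - \<theta>)))"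
  have bound: "(\<Sum>k<n. \<bar>G r (a k) - G r (a (Suc k))\<bar>) \<le> 2 * pi * (u 0 + v 0)" if r: "0 < r" "r < 1" for r
  proof -
    let ?z = "\<lambda>\<theta>. of_real r * cis \<theta>"
    have r0: "0 \<le> r" using r by simp
    have z: "?z \<theta> \<in> unit_disc" for \<theta> using r by (simp add: norm_mult)
    \<comment> \<open>As \<open>u\<close> and \<open>v\<close> are nonnegative, \<open>w\<close>
      dominates \<open>\<bar>u - v\<bar>\<close> on the circle. Increments of \<open>G r\<close> are
      thus bounded by those of the monotone primitive \<open>I\<close>, which telescope.\<close>
    define w where "w = (\<lambda>\<theta>. u (?z \<theta>) + v (?z \<theta>))"
    define I where "I = (\<lambda>\<theta>. integral {-pi..\<theta>} w)"
    have w0: "0 \<le> w \<theta>" for \<theta> using nonneg z by (simp add: w_def add_nonneg_nonneg)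
    have wint: "(w has_integral 2 * pi * (u 0 + v 0)) {-pi..pi}"
      unfolding w_def distrib_left
      by (intro has_integral_add harmonic_circle_integral[OF harm(1) r0 r(2)]
          harmonic_circle_integral[OF harm(2) r0 r(2)])
    have wsub: "w integrable_on {b..c}" if "-pi \<le> b" "c \<le> pi" for b c
      by (rule integrable_on_subinterval[OF has_integral_integrable[OF wint]]) (use that in auto)
    have I_diff: "integral {b..c} w = I c - I b" if "-pi \<le> b" "b \<le> c" "c \<le> pi" for b c
      using Henstock_Kurzweil_Integration.integral_combine[OF that(1,2) wsub[OF _ that(3)]]
      by (simp add: I_def)
    have I_mono: "I b \<le> I c" if "-pi \<le> b" "b \<le> c" "c \<le> pi" for b c
      using I_diff[OF that] integral_nonneg[OF wsub[OF that(1,3)]] w0 by simp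
    have step: "\<bar>G r c - G r b\<bar> \<le> I c - I b" if "-pi \<le> b" "b \<le> c" "c \<le> pi" for b c
    proof -
      have "(G r has_real_derivative poisson_integral f (?z \<theta>)) (at \<theta>)" for \<theta>
        unfolding G_def
        by (rule poisson_integral_angular_antiderivative[OF \<open>finite S\<close> cont per deriv r0 r(2)])
      then have *: "((\<lambda>\<theta>. poisson_integral f (?z \<theta>)) has_integral G r c - G r b) {b..c}"
        using that by (intro fundamental_theorem_of_calculus)
           (auto simp: has_real_derivative_iff_has_vector_derivative[symmetric]
             intro: has_field_derivative_at_within)
      have "norm (integral {b..c} (\<lambda>\<theta>. poisson_integral f (?z \<theta>))) \<le> integral {b..c} w"
      proof (rule integral_norm_bound_integral)
        show "(\<lambda>\<theta>. poisson_integral f (?z \<theta>)) integrable_on {b..c}" using * by blast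
        show "w integrable_on {b..c}" using that by (intro wsub)
        fix \<theta>
        have "0 \<le> u (?z \<theta>)" "0 \<le> v (?z \<theta>)" using nonneg z by blast+
        then show "norm (poisson_integral f (?z \<theta>)) \<le> w \<theta>"
          unfolding eq[OF z] w_def real_norm_def by linarith
      qed
      then show ?thesis by (simp add: integral_unique[OF *] I_diff[OF that])
    qed
    have a': "-pi \<le> a k" "a k \<le> pi" "a (Suc k) \<le> a k" for k
      using a(2)[of k] decseqD[OF a(1), of k "Suc k"] by auto
    have "(\<Sum>k<n. \<bar>G r (a k) - G r (a (Suc k))\<bar>) \<le> (\<Sum>k<n. I (a k) - I (a (Suc k)))"
      by (intro sum_mono step a')
    also have "\<dots> = I (a 0) - I (a n)" by (rule sum_lessThan_telescope')
    also have "\<dots> \<le> I pi - I (-pi)"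
      by (intro diff_mono I_mono a' order_refl)
    also have "\<dots> = 2 * pi * (u 0 + v 0)" by (simp add: I_def integral_unique[OF wint])
    finally show ?thesis .
  qed
  have "((\<lambda>r. \<Sum>k<n. \<bar>G r (a k) - G r (a (Suc k))\<bar>) \<longlongrightarrow> (\<Sum>k<n. \<bar>F (a k) - F (a (Suc k))\<bar>)) (at_left 1)"
    unfolding G_def by (intro tendsto_intros poisson_integral_tendsto cont) (use a(2) in \<open>simp_all\<close>)
  moreover have "\<forall>\<^sub>F r in at_left (1::real). (\<Sum>k<n. \<bar>G r (a k) - G r (a (Suc k))\<bar>) \<le> 2 * pi * (u 0 + v 0)"
    by (rule eventually_mono[OF eventually_at_left_real[OF zero_less_one]]) (auto intro: bound)
  ultimately show ?thesis by (rule tendsto_upperbound) simp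
qed

section \<open>The counterexample\<close>

lemma continuous_on_times_sin_inverse: "continuous_on UNIV (\<lambda>y::real. y * sin (1 / y))"
proof -
  have "isCont (\<lambda>y::real. y * sin (1 / y)) x" for x
  proof (cases "x = 0")
    case True
    have "((\<lambda>y::real. y * sin (1 / y)) \<longlongrightarrow> 0) (at 0)"
    proof (rule Lim_null_comparison)
      show "\<forall>\<^sub>F y in at 0. norm (y * sin (1 / y)) \<le> \<bar>y::real\<bar>"
        by (simp add: abs_mult mult_left_le)
      show "((\<lambda>y::real. \<bar>y\<bar>) \<longlongrightarrow> 0) (at 0)" by (rule tendsto_rabs_zero) (rule tendsto_ident_at)
    qed
    then show ?thesis by (simp add: True isCont_def)
  qed (auto intro!: continuous_intros)
  then show ?thesis by (simp add: continuous_on_eq_continuous_at)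
qed

theorem mainTheorem3:
  shows "\<exists>f\<in>HK. \<not> (\<exists>u v :: complex \<Rightarrow> real.
           harmonic_on u unit_disc \<and> harmonic_on v unit_disc \<and>
           (\<forall>z\<in>unit_disc. u z > 0) \<and> (\<forall>z\<in>unit_disc. v z > 0) \<and>
           (\<forall>z\<in>unit_disc. poisson_integral f z = u z - v z))"
proof -
  \<comment> \<open>Substituting \<open>sin x\<close> into \<open>y * sin (1 / y)\<close> makes the
    example periodic while keeping the oscillation at 0. Where \<open>sin x = 0\<close>, division by
    zero gives \<open>F x = 0\<close>, the continuous value.\<close>
  define F :: "real \<Rightarrow> real" where "F = (\<lambda>x. sin x * sin (1 / sin x))"
  define f :: "real \<Rightarrow> real" where "f = (\<lambda>x. cos x * (sin (1 / sin x) - cos (1 / sin x) / sin x))"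
  have cont: "continuous_on {-pi..pi} F"
    unfolding F_def
    by (rule continuous_on_compose2[OF continuous_on_times_sin_inverse]) (auto intro!: continuous_intros)
  have deriv: "(F has_real_derivative f x) (at x)" if "x \<in> {-pi<..<pi} - {0}" for x
  proof -
    have nz: "sin x \<noteq> 0"
    proof (cases "x > 0")
      case True
      then show ?thesis using sin_gt_zero[of x] that by simp
    next
      case False
      then show ?thesis using sin_gt_zero[of "- x"] that by simp
    qed
    then have "((\<lambda>x. 1 / sin x) has_real_derivative - cos x / (sin x)\<^sup>2) (at x)"
      by (auto intro!: derivative_eq_intros simp: power2_eq_square)
    from DERIV_mult[OF DERIV_sin DERIV_chain2[OF DERIV_sin this]]
    show ?thesis
      unfolding F_def f_def
      by (rule DERIV_cong) (use nz in \<open>simp add: field_simps power2_eq_square\<close>)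
  qed
  have per: "F (-pi) = F pi" by (simp add: F_def)
  \<comment> \<open>Although \<open>f\<close> is unbounded near 0, continuity of \<open>F\<close>
    there lets the fundamental theorem bridge the exceptional point.\<close>
  have "(f has_integral (F pi - F (-pi))) {-pi..pi}"
    by (rule fundamental_theorem_of_calculus_interior_strong[of "{0}"])
       (use deriv cont in \<open>auto simp: has_real_derivative_iff_has_vector_derivative\<close>)
  then have "f integrable_on {-pi..pi}" by blast
  then have "f \<in> HK" by (simp add: HK_def f_def)
  \<comment> \<open>The reciprocals are \<open>k * pi + pi / 2\<close>, where the sine is
    alternately 1 and -1; \<open>arcsin\<close> later carries these heights back to angles.\<close>
  define x :: "nat \<Rightarrow> real" where "x = (\<lambda>k. 1 / (pi * (real k + 1 / 2)))"
  have x: "0 < x k" "x k \<le> 1" for k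
  proof -
    show "0 < x k" by (simp add: x_def add_nonneg_pos)
    have "2 * (1 / 2) \<le> pi * (real k + 1 / 2)"
      using pi_ge_two by (intro mult_mono) auto
    then show "x k \<le> 1" by (simp add: x_def)
  qed
  have x_dec: "x (Suc k) \<le> x k" for k
    unfolding x_def by (intro divide_left_mono mult_left_mono mult_pos_pos) (auto simp: add_nonneg_pos)
  define a where "a = (\<lambda>k. arcsin (x k))"
  have "-1 \<le> x k" for k using x(1)[of k] by linarith
  then have "decseq a"
    unfolding a_def by (intro decseq_SucI arcsin_le_arcsin x_dec x)
  have a: "a k \<in> {-pi<..<pi}" for k
  proof -
    have "- (pi / 2) \<le> a k \<and> a k \<le> pi / 2"
      using arcsin_bounded[of "x k"] x[of k] by (simp add: a_def)
    then show ?thesis using pi_gt_zero unfolding greaterThanLessThan_iff by linarith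
  qed
  have Fa: "F (a k) = x k * (-1) ^ k" for k
  proof -
    have "sin (a k) = x k" using x[of k] by (simp add: a_def)
    moreover have "1 / x k = real k * pi + pi / 2" by (simp add: x_def algebra_simps)
    ultimately show ?thesis by (simp add: F_def sin_add)
  qed
  \<comment> \<open>Consecutive values have opposite signs, so their sizes add up.\<close>
  have jump: "\<bar>F (a k) - F (a (Suc k))\<bar> = x k + x (Suc k)" for k
  proof -
    have "F (a k) - F (a (Suc k)) = (x k + x (Suc k)) * (-1) ^ k" by (simp add: Fa algebra_simps)
    then show ?thesis using x[of k] x[of "Suc k"] by (simp add: abs_mult)
  qed
  \<comment> \<open>Here \<open>harm n\<close> is the harmonic number:
    \<open>k + 1 / 2 \<le> k + 1\<close> makes \<open>x k\<close> at least
    \<open>1 / (pi * (k + 1))\<close>, so the variation sums diverge.\<close>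
  have lower: "harm n / pi \<le> (\<Sum>k<n. \<bar>F (a k) - F (a (Suc k))\<bar>)" for n
  proof -
    have "harm n / pi = (\<Sum>k<n. inverse (real (Suc k)) / pi)"
      by (simp add: harm_altdef sum_divide_distrib)
    also have "\<dots> \<le> (\<Sum>k<n. \<bar>F (a k) - F (a (Suc k))\<bar>)"
    proof (rule sum_mono)
      fix k
      have "inverse (real (Suc k)) / pi = 1 / (pi * real (Suc k))" by (simp add: field_simps)
      also have "\<dots> \<le> x k"
        unfolding x_def by (intro divide_left_mono mult_left_mono mult_pos_pos) (auto simp: add_nonneg_pos)
      also have "\<dots> \<le> \<bar>F (a k) - F (a (Suc k))\<bar>" using x[of "Suc k"] by (simp add: jump)
      finally show "inverse (real (Suc k)) / pi \<le> \<bar>F (a k) - F (a (Suc k))\<bar>" .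
    qed
    finally show ?thesis .
  qed
  show ?thesis
  proof (intro bexI[OF _ \<open>f \<in> HK\<close>] notI, elim exE conjE)
    fix u v :: "complex \<Rightarrow> real"
    assume harm: "harmonic_on u unit_disc" "harmonic_on v unit_disc"
      and pos: "\<forall>z\<in>unit_disc. u z > 0" "\<forall>z\<in>unit_disc. v z > 0"
      and eq: "\<forall>z\<in>unit_disc. poisson_integral f z = u z - v z"
    have "harm n / pi \<le> 2 * pi * (u 0 + v 0)" for n
    proof (rule order_trans[OF lower])
      show "(\<Sum>k<n. \<bar>F (a k) - F (a (Suc k))\<bar>) \<le> 2 * pi * (u 0 + v 0)"
        by (rule poisson_integral_difference_bounded_variation[where S = "{0}", OF _ cont per deriv harm _ _ _ \<open>decseq a\<close> a])
           (use pos eq in \<open>auto intro: less_imp_le\<close>)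
    qed
    then have le: "harm n \<le> 2 * pi * (u 0 + v 0) * pi" for n
      by (simp add: pos_divide_le_eq)
    obtain n :: nat where "harm n > 2 * pi * (u 0 + v 0) * pi"
      using filterlim_at_top_dense[THEN iffD1, OF harm_at_top] eventually_happens'[OF sequentially_bot] by blast
    with le[of n] show False by simp
  qed
qed

end
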